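(* For real $x>0$ let $J(x)=\int_{0}^{1}\frac{\log(1+t^x)}{1+t}\,dt$. Let $m$ be any positive odd integer. Then $$J(m)=\frac{m}{2}\log^2 2-\frac{(m^2-1)\pi^2}{24m}+\frac{1}{2}\sum_{k=0}^{\frac{m-3}{2}}\operatorname{Li}_2\left(\cos^2\left(\frac{(2k+1)\pi}{2m}\right)\right)$$ and $$J\left(\frac{1}{m}\right)=\frac{2-m}{2}\log^2 2+\frac{(m^2-1)\pi^2}{24m}-\frac{1}{2}\sum_{k=0}^{\frac{m-3}{2}}\operatorname{Li}_2\left(\cos^2\left(\frac{(2k+1)\pi}{2m}\right)\right).$$
   Context: The dilogarithm is $\operatorname{Li}_2(z)=\sum_{k=1}^{\infty}\frac{z^k}{k^2}$ for $|z|\le 1$. An empty sum (which occurs for $m=1$) is interpreted as zero. $\log^2 2$ means $(\log 2)^2$. *)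

theory Defs
  imports "HOL-Analysis.Analysis"
begin

text \<open>
  The dilogarithm; meaningful only for \<open>norm z \<le> 1\<close>, where the series converges.
  The series is shifted by one, so that \<open>Suc k\<close> runs over the positive integers.
\<close>

definition Li2 :: "'a::{real_normed_field,banach} \<Rightarrow> 'a" where
  "Li2 z = (\<Sum>k. z ^ Suc k / of_nat (Suc k) ^ 2)"

text \<open>
  Intended for \<open>x > 0\<close>; then \<open>0 powr x = 0\<close> is the usual value at the left endpoint,
  and the integrand is continuous on the closed unit interval.
\<close>

definition J :: "real \<Rightarrow> real" where
  "J x = integral {0..1} (\<lambda>t. ln (1 + t powr x) / (1 + t))"

end

theory Submission
  imports Defs
begin

text \<open>
  For odd \<open>m\<close>, factoring \<open>z ^ m - 1\<close> at \<open>z = -t\<close> and taking squared absolute values gives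
  \<open>(1 + t ^ m)\<^sup>2 = (\<Prod>k<m. 1 + 2 t cos \<phi>\<^sub>k + t\<^sup>2)\<close> with \<open>\<phi>\<^sub>k = 2 \<pi> k / m\<close>, so \<open>J m\<close> is half the
  sum of the integrals \<open>I(\<phi>\<^sub>k)\<close>, where \<open>I(\<phi>) = \<integral>\<^sub>0\<^sup>1 ln (1 + 2 t cos \<phi> + t\<^sup>2) / (1 + t) dt\<close>.
  Differentiating under the integral sign, \<open>I(\<phi>)\<close> and \<open>Li2 (sin\<^sup>2 (\<phi>/2)) / 2 - \<phi>\<^sup>2 / 4\<close> have the same
  derivative on \<open>(0, \<pi>)\<close>, so they differ by the constant \<open>I(0) = ln\<^sup>2 2\<close>. The terms for \<open>k\<close> and
  \<open>m - k\<close> agree, and \<open>sin (\<phi>\<^sub>k / 2) = cos ((m - 2 k) \<pi> / (2 m))\<close>. Finally, the substitution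
  \<open>t = u ^ m\<close> and integration by parts give \<open>J m + J (1 / m) = ln\<^sup>2 2\<close>.
\<close>

section \<open>Factorisation of \<open>1 + t ^ n\<close> through the roots of unity\<close>

lemma prod_minus_roots_unity:
  fixes z :: complex
  assumes "n > 0"
  shows "(\<Prod>k<n. z - cis (2 * pi * real k / real n)) = z ^ n - 1"
proof -
  define w where "w = (\<lambda>k. cis (2 * pi * real k / real n))"
  define p where "p = (\<Prod>k<n. [:- w k, 1:])"
  define q :: "complex poly" where "q = monom 1 n - 1"
  have bij: "bij_betw w {..<n} {z. z ^ n = 1}"
    unfolding w_def by (rule Complex.bij_betw_roots_unity) fact
  have degp: "degree p = n"
    unfolding p_def by (subst degree_prod_eq_sum_degree) auto
  have "lead_coeff p = 1"
    unfolding p_def by (subst lead_coeff_prod) auto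
  have "p = q"
  \<comment> \<open>Both polynomials have degree at most \<open>n\<close>, the same coefficient at
    \<open>n\<close>, and agree at the \<open>n\<close> distinct roots of unity. Their difference
    has degree below \<open>n\<close> and \<open>n\<close> zeros, so it vanishes.\<close>
  proof (rule poly_eqI_degree_lead_coeff[where n = n and A = "{z. z ^ n = 1}"])
    show "coeff p n = coeff q n"
      using \<open>lead_coeff p = 1\<close> degp assms by (simp add: q_def)
    show "n \<le> card {z :: complex. z ^ n = 1}"
      using card_roots_unity_eq[OF assms] by simp
    show "degree q \<le> n"
      unfolding q_def by (intro degree_diff_le degree_monom_le) auto
    show "poly p z = poly q z" if "z \<in> {z. z ^ n = 1}" for z
    proof -
      have "z \<in> w ` {..<n}"
        using that by (simp only: bij_betw_imp_surj_on[OF bij])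
      then obtain k where k: "k < n" "z = w k"
        by (elim imageE) simp
      have "poly p z = (\<Prod>i<n. z - w i)"
        by (simp add: p_def poly_prod)
      also have "\<dots> = 0"
        by (rule prod_zero) (use k in auto)
      finally have "poly p z = 0" .
      thus ?thesis
        using that by (simp add: q_def poly_monom)
    qed
  qed (use degp in simp)
  hence "poly p z = poly q z" by simp
  thus ?thesis
    by (simp add: p_def q_def w_def poly_prod poly_monom)
qed

lemma one_plus_power_square_eq_prod:
  fixes t :: real
  assumes "odd n"
  shows "(1 + t ^ n)\<^sup>2 = (\<Prod>k<n. 1 + 2 * t * cos (2 * pi * real k / real n) + t\<^sup>2)"
proof -
  have "n > 0" using assms by (auto intro: Nat.gr0I)
  have eq: "(norm (complex_of_real (-t) - cis x))\<^sup>2 = 1 + 2 * t * cos x + t\<^sup>2" for x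
  proof -
    have "(norm (complex_of_real (-t) - cis x))\<^sup>2 = (t + cos x)\<^sup>2 + (sin x)\<^sup>2"
      by (simp add: cmod_power2 power2_commute) (simp add: power2_eq_square algebra_simps)
    thus ?thesis
      using sin_cos_squared_add[of x] by (simp add: power2_eq_square algebra_simps)
  qed
  have "(1 + t ^ n)\<^sup>2 = (norm (complex_of_real (-t) ^ n - 1))\<^sup>2"
  proof -
    \<comment> \<open>Oddness enters here: \<open>(-t) ^ n = - (t ^ n)\<close>.\<close>
    have "complex_of_real (-t) ^ n - 1 = complex_of_real (- (1 + t ^ n))"
      using assms by simp
    thus ?thesis by (metis norm_of_real power2_abs power2_minus)
  qed
  also have "\<dots> = (\<Prod>k<n. (norm (complex_of_real (-t) - cis (2 * pi * real k / real n)))\<^sup>2)"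
    by (subst prod_minus_roots_unity[OF \<open>n > 0\<close>, symmetric])
       (simp only: prod_norm [symmetric] prod_power_distrib)
  finally show ?thesis by (simp only: eq)
qed

text \<open>Each quadratic factor is a sum of two squares, hence nonnegative, and none vanishes
  because their product \<open>(1 + t ^ n)\<^sup>2\<close> is positive. So the logarithm of the
  product splits.\<close>

lemma ln_one_plus_power_eq_sum:
  fixes t :: real
  assumes "odd n" "t \<ge> 0"
  shows "2 * ln (1 + t ^ n) = (\<Sum>k<n. ln (1 + 2 * t * cos (2 * pi * real k / real n) + t\<^sup>2))"
proof -
  have "1 + t ^ n > 0" using assms(2) by (simp add: add_pos_nonneg)
  let ?f = "\<lambda>k. 1 + 2 * t * cos (2 * pi * real k / real n) + t\<^sup>2"
  have "(\<Prod>k<n. ?f k) \<noteq> 0"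
    using one_plus_power_square_eq_prod[OF assms(1), of t] power_not_zero[of "1 + t ^ n" 2] \<open>1 + t ^ n > 0\<close>
    by linarith
  hence nz: "?f k \<noteq> 0" if "k < n" for k
    using prod_zero[of "{..<n}" ?f] that by blast
  have nonneg: "?f k \<ge> 0" for k
  proof -
    have "?f k = (t + cos (2 * pi * real k / real n))\<^sup>2 + (sin (2 * pi * real k / real n))\<^sup>2"
      using sin_cos_squared_add[of "2 * pi * real k / real n"]
      by (simp add: power2_eq_square algebra_simps)
    thus ?thesis by simp
  qed
  have "2 * ln (1 + t ^ n) = ln ((1 + t ^ n)\<^sup>2)"
    using \<open>1 + t ^ n > 0\<close> by (simp add: ln_realpow)
  also have "\<dots> = (\<Sum>k<n. ln (?f k))"
    unfolding one_plus_power_square_eq_prod[OF assms(1)]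
    using nz nonneg by (intro ln_prod) (auto simp: less_le)
  finally show ?thesis .
qed

section \<open>The derivative of the real dilogarithm\<close>

lemma Li2_0 [simp]: "Li2 0 = 0"
  by (simp add: Li2_def)

text \<open>Termwise differentiation inside the unit interval. The derivative stays a series so that
  it is also correct at \<open>x = 0\<close>, where its value is 1 but
  \<open>- ln (1 - x) / x\<close> would evaluate to 0.\<close>

lemma has_field_derivative_Li2:
  fixes x :: real
  assumes "\<bar>x\<bar> < 1"
  shows "(Li2 has_field_derivative (\<Sum>k. x ^ k / real (Suc k))) (at x)"
proof -
  have coeff: "1 / (real (Suc k))\<^sup>2 * real (Suc k) = 1 / real (Suc k)" for k
    by (simp add: power2_eq_square)
  have sm: "summable (\<lambda>k. 1 / (real (Suc k))\<^sup>2 * real (Suc k) * y ^ k)" if "y \<in> {-1<..<1}" for y :: real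
    unfolding coeff
  proof (rule summable_comparison_test'[where N = 0])
    show "summable (\<lambda>k. \<bar>y\<bar> ^ k)" using that by (intro summable_geometric) auto
    show "norm (1 / real (Suc k) * y ^ k) \<le> \<bar>y\<bar> ^ k" for k
      using mult_right_mono[of 1 "real (Suc k)" "\<bar>y\<bar> ^ k"]
      by (simp add: power_abs abs_mult pos_divide_le_eq mult.commute del: of_nat_Suc)
  qed
  have "((\<lambda>x. \<Sum>k. 1 / (real (Suc k))\<^sup>2 * x ^ Suc k) has_field_derivative
          (\<Sum>k. 1 / (real (Suc k))\<^sup>2 * real (Suc k) * x ^ k)) (at x)"
    by (rule DERIV_power_series'[where R = 1]) (use sm assms in \<open>auto simp del: of_nat_Suc\<close>)
  thus ?thesis
    unfolding coeff Li2_def[abs_def] by (simp del: of_nat_Suc)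
qed

lemma suminf_power_over_Suc:
  fixes x :: real
  assumes "\<bar>x\<bar> < 1" "x \<noteq> 0"
  shows "(\<Sum>k. x ^ k / real (Suc k)) = - ln (1 - x) / x"
proof -
  have "(\<lambda>n. - (x ^ n) / real n) sums ln (1 - x)"
    using ln_series'[of "-x"] assms by simp
  \<comment> \<open>The dropped term at \<open>n = 0\<close> is \<open>-1 / 0\<close>, which is 0 by
    convention, so the shift leaves the sum unchanged.\<close>
  hence "(\<lambda>n. - (x ^ Suc n) / real (Suc n)) sums ln (1 - x)"
    by (subst sums_Suc_iff) simp
  hence "(\<lambda>n. (- 1 / x) * (- (x ^ Suc n) / real (Suc n))) sums ((- 1 / x) * ln (1 - x))"
    by (rule sums_mult)
  moreover have "(- 1 / x) * (- (x ^ Suc n) / real (Suc n)) = x ^ n / real (Suc n)" for n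
    using assms(2) by simp
  ultimately show ?thesis by (simp add: sums_iff del: of_nat_Suc)
qed

section \<open>Closed form of the parametric integrals \<open>log_quad_integral\<close>\<close>

lemma one_plus_two_cos_pos:
  fixes t \<phi> :: real
  assumes "t \<ge> 0" "0 \<le> \<phi>" "\<phi> < pi"
  shows "1 + 2 * t * cos \<phi> + t\<^sup>2 > 0"
proof -
  have "cos \<phi> > cos pi"
    using assms by (intro cos_monotone_0_pi) auto
  hence "cos \<phi> > -1" by simp
  show ?thesis
  proof (cases "t = 0")
    case False
    \<comment> \<open>Replacing \<open>cos \<phi>\<close> by -1 bounds the quadratic strictly from
      below by \<open>(1 - t)\<^sup>2\<close>.\<close>
    hence "2 * t * cos \<phi> > 2 * t * (-1)"
      using \<open>cos \<phi> > -1\<close> assms(1) by (intro mult_strict_left_mono) auto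
    moreover have "(1 - t)\<^sup>2 \<ge> 0" by simp
    ultimately show ?thesis by (simp add: power2_eq_square algebra_simps)
  qed auto
qed

definition log_quad_integral :: "real \<Rightarrow> real" where
  "log_quad_integral \<phi> = integral {0..1} (\<lambda>t. ln (1 + 2 * t * cos \<phi> + t\<^sup>2) / (1 + t))"

lemma integrable_log_quad:
  assumes "0 \<le> \<phi>" "\<phi> < pi"
  shows "(\<lambda>t. ln (1 + 2 * t * cos \<phi> + t\<^sup>2) / (1 + t)) integrable_on {0..1}"
proof (intro integrable_continuous_real continuous_intros ballI)
  show "1 + 2 * t * cos \<phi> + t\<^sup>2 \<noteq> 0" if "t \<in> {0..1}" for t
    using one_plus_two_cos_pos[of t \<phi>] that assms by auto
qed auto

text \<open>Leibniz rule on a half-open parameter range. The point 0 is included to obtain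
  continuity there later; \<open>pi\<close> is excluded because the quadratic then vanishes at
  \<open>t = 1\<close>.\<close>

lemma has_field_derivative_log_quad_integral:
  assumes "0 \<le> \<phi>" "\<phi> < pi"
  shows "(log_quad_integral has_field_derivative
           integral {0..1} (\<lambda>t. - 2 * t * sin \<phi> / (1 + 2 * t * cos \<phi> + t\<^sup>2) / (1 + t)))
         (at \<phi> within {0..<pi})"
proof -
  have "((\<lambda>\<phi>. integral (cbox 0 1) (\<lambda>t. ln (1 + 2 * t * cos \<phi> + t\<^sup>2) / (1 + t))) has_field_derivative
           integral (cbox 0 1) (\<lambda>t. - 2 * t * sin \<phi> / (1 + 2 * t * cos \<phi> + t\<^sup>2) / (1 + t)))
         (at \<phi> within {0..<pi})"
  proof (rule leibniz_rule_field_derivative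
      [where fx = "\<lambda>\<phi> t. - 2 * t * sin \<phi> / (1 + 2 * t * cos \<phi> + t\<^sup>2) / (1 + t)"])
    fix x t :: real
    assume "x \<in> {0..<pi}" "t \<in> cbox 0 1"
    hence "1 + 2 * t * cos x + t\<^sup>2 > 0" "1 + t > 0"
      using one_plus_two_cos_pos[of t x] by auto
    thus "((\<lambda>x. ln (1 + 2 * t * cos x + t\<^sup>2) / (1 + t)) has_field_derivative
        - 2 * t * sin x / (1 + 2 * t * cos x + t\<^sup>2) / (1 + t)) (at x within {0..<pi})"
      by (auto intro!: derivative_eq_intros)
  next
    show "continuous_on ({0..<pi} \<times> cbox 0 1)
           (\<lambda>(x, t). - 2 * t * sin x / (1 + 2 * t * cos x + t\<^sup>2) / (1 + t))"
      unfolding split_beta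
    proof (intro continuous_intros ballI)
      show "1 + 2 * snd z * cos (fst z) + (snd z)\<^sup>2 \<noteq> 0" if "z \<in> {0..<pi} \<times> cbox 0 1" for z :: "real \<times> real"
        using one_plus_two_cos_pos[of "snd z" "fst z"] that by auto
    qed auto
  qed (use integrable_log_quad assms in auto)
  thus ?thesis by (simp add: log_quad_integral_def[abs_def])
qed

lemma arctan_cot:
  assumes "0 < x" "x < pi"
  shows "arctan (cos x / sin x) = pi / 2 - x"
proof -
  have "tan (pi / 2 - x) = cos x / sin x"
    by (simp add: tan_def cos_diff sin_diff)
  moreover have "arctan (tan (pi / 2 - x)) = pi / 2 - x"
    using assms by (intro arctan_tan) auto
  ultimately show ?thesis by simp
qed

text \<open>In the final comparison the logarithmic term cancels against the derivative of the
  dilogarithm, and \<open>- \<phi> / 2\<close> against that of \<open>\<phi>\<^sup>2 / 4\<close>.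
  The point 0 is left out because \<open>1 - cos \<phi>\<close> vanishes there.\<close>

lemma integral_log_quad_deriv:
  assumes "0 < \<phi>" "\<phi> < pi"
  shows "integral {0..1} (\<lambda>t. - 2 * t * sin \<phi> / (1 + 2 * t * cos \<phi> + t\<^sup>2) / (1 + t))
       = - sin \<phi> / (2 * (1 - cos \<phi>)) * ln ((1 + cos \<phi>) / 2) - \<phi> / 2"
proof -
  define c s where "c = cos \<phi>" and "s = sin \<phi>"
  have s: "s > 0" using assms by (simp add: s_def sin_gt_zero)
  have cs: "s\<^sup>2 + c\<^sup>2 = 1" by (simp add: c_def s_def)
  have "c < 1" "c > -1"
    using cos_monotone_0_pi[of 0 \<phi>] cos_monotone_0_pi[of \<phi> pi] assms by (auto simp: c_def)
  \<comment> \<open>Found by partial fractions. With Q the quadratic, Q(-1) = 2(1 - c), so the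
    residue at t = -1 is s/(1 - c). The remaining numerator over Q is a multiple of Q'/2 = t + c
    plus the constant -s; since Q = s^2 + (t + c)^2, the latter integrates to the
    arctangent.\<close>
  define G where "G = (\<lambda>t. - s / (1 - c) * (ln (1 + 2 * t * c + t\<^sup>2) / 2 - ln (1 + t))
                             - arctan ((t + c) / s))"
  have "((\<lambda>t. - 2 * t * s / (1 + 2 * t * c + t\<^sup>2) / (1 + t)) has_integral (G 1 - G 0)) {0..1}"
  proof (rule fundamental_theorem_of_calculus)
    fix t :: real
    assume t: "t \<in> {0..1}"
    define Q where "Q = 1 + 2 * t * c + t\<^sup>2"
    have Q: "Q > 0"
      using one_plus_two_cos_pos[of t \<phi>] t assms by (simp add: c_def Q_def)
    have atan: "1 / (1 + ((t + c) / s)\<^sup>2) / s = s / Q"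
    proof -
      have "Q = s\<^sup>2 + (t + c)\<^sup>2" using cs by (simp add: Q_def power2_eq_square algebra_simps)
      hence "1 + ((t + c) / s)\<^sup>2 = Q / s\<^sup>2"
        unfolding power_divide using s by (simp add: field_simps)
      thus ?thesis using s by (simp add: power2_eq_square)
    qed
    have "((\<lambda>t. ln (1 + 2 * t * c + t\<^sup>2) / 2) has_field_derivative (2 * c + 2 * t) / Q / 2) (at t within {0..1})"
      by (rule DERIV_cdivide) (use Q in \<open>auto intro!: derivative_eq_intros simp: Q_def\<close>)
    moreover have "((\<lambda>t. ln (1 + t)) has_field_derivative 1 / (1 + t)) (at t within {0..1})"
      using t by (auto intro!: derivative_eq_intros)
    moreover have "((\<lambda>t. arctan ((t + c) / s)) has_field_derivative 1 / (1 + ((t + c) / s)\<^sup>2) / s)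
        (at t within {0..1})"
      using s by (auto intro!: derivative_eq_intros simp: divide_inverse)
    ultimately have "(G has_field_derivative
            - s / (1 - c) * ((2 * c + 2 * t) / Q / 2 - 1 / (1 + t)) - 1 / (1 + ((t + c) / s)\<^sup>2) / s) (at t within {0..1})"
      unfolding G_def by (intro DERIV_diff DERIV_cmult)
    also have "- s / (1 - c) * ((2 * c + 2 * t) / Q / 2 - 1 / (1 + t)) - 1 / (1 + ((t + c) / s)\<^sup>2) / s
             = - 2 * t * s / Q / (1 + t)"
    proof -
      have "(- s / (1 - c) * ((2 * c + 2 * t) / Q / 2 - 1 / (1 + t)) - s / Q)
             = - s * ((c + t) * (1 + t) - Q + (1 - c) * (1 + t)) / ((1 - c) * (1 + t) * Q)"
        using \<open>c < 1\<close> t Q by (simp add: divide_simps) (simp add: algebra_simps)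
      also have "(c + t) * (1 + t) - Q + (1 - c) * (1 + t) = 2 * t * (1 - c)"
        by (simp add: Q_def power2_eq_square algebra_simps)
      also have "- s * (2 * t * (1 - c)) / ((1 - c) * (1 + t) * Q) = - 2 * t * s / Q / (1 + t)"
        using \<open>c < 1\<close> t Q by (simp add: divide_simps)
      finally show ?thesis by (simp only: atan)
    qed
    finally show "(G has_vector_derivative - 2 * t * s / (1 + 2 * t * c + t\<^sup>2) / (1 + t)) (at t within {0..1})"
      by (simp add: Q_def has_real_derivative_iff_has_vector_derivative)
  qed auto
  hence "integral {0..1} (\<lambda>t. - 2 * t * s / (1 + 2 * t * c + t\<^sup>2) / (1 + t)) = G 1 - G 0"
    by (rule integral_unique)
  also have "\<dots> = - s / (1 - c) * (ln (2 + 2 * c) / 2 - ln 2) - (arctan ((1 + c) / s) - arctan (c / s))"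
    by (simp add: G_def)
  also have "ln (2 + 2 * c) / 2 - ln 2 = ln ((1 + c) / 2) / 2"
  proof -
    have "2 + 2 * c = 2\<^sup>2 * ((1 + c) / 2)" by (simp add: field_simps)
    hence "ln (2 + 2 * c) = ln (2\<^sup>2 * ((1 + c) / 2))" by (rule arg_cong)
    also have "\<dots> = 2 * ln 2 + ln ((1 + c) / 2)"
      using \<open>c > -1\<close> ln_realpow[of 2 2] by (subst ln_mult) auto
    finally show ?thesis by (simp add: add_divide_distrib)
  qed
  also have "arctan (c / s) = pi / 2 - \<phi>"
    unfolding c_def s_def using assms by (rule arctan_cot)
  \<comment> \<open>By the half-angle formulas, \<open>(1 + c) / s\<close> is the cotangent of
    \<open>\<phi> / 2\<close>; the two arctangents therefore differ by
    \<open>\<phi> / 2\<close>.\<close>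
  also have "arctan ((1 + c) / s) = pi / 2 - \<phi> / 2"
  proof -
    have "sin (\<phi> / 2) > 0" "cos (\<phi> / 2) > 0"
      using assms by (auto intro!: sin_gt_zero cos_gt_zero_pi)
    moreover have "s = 2 * sin (\<phi> / 2) * cos (\<phi> / 2)"
      unfolding s_def using sin_double[of "\<phi> / 2"] by simp
    moreover have "1 + c = 2 * (cos (\<phi> / 2))\<^sup>2"
      unfolding c_def using cos_double_cos[of "\<phi> / 2"] by simp
    ultimately have "(1 + c) / s = cos (\<phi> / 2) / sin (\<phi> / 2)"
      by (simp add: power2_eq_square)
    thus ?thesis using arctan_cot[of "\<phi> / 2"] assms by simp
  qed
  finally show ?thesis by (simp add: c_def s_def)
qed

text \<open>At angle 0 the quadratic is a perfect square and the integrand is the derivative of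
  ln^2(1 + t). This value fixes the constant of integration.\<close>

lemma log_quad_integral_0: "log_quad_integral 0 = (ln 2)\<^sup>2"
proof -
  have "((\<lambda>t. ln (1 + 2 * t * cos 0 + t\<^sup>2) / (1 + t)) has_integral ((ln (1 + 1))\<^sup>2 - (ln (1 + 0))\<^sup>2)) {0..1::real}"
  proof (rule fundamental_theorem_of_calculus)
    fix t :: real
    assume t: "t \<in> {0..1}"
    have "1 + 2 * t * cos 0 + t\<^sup>2 = (1 + t)\<^sup>2" by (simp add: power2_eq_square algebra_simps)
    hence "ln (1 + 2 * t * cos 0 + t\<^sup>2) = 2 * ln (1 + t)"
      using t by (simp add: ln_realpow)
    moreover have "((\<lambda>t. (ln (1 + t))\<^sup>2) has_field_derivative 2 * ln (1 + t) / (1 + t)) (at t within {0..1})"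
      using t by (auto intro!: derivative_eq_intros)
    ultimately show "((\<lambda>t. (ln (1 + t))\<^sup>2) has_vector_derivative ln (1 + 2 * t * cos 0 + t\<^sup>2) / (1 + t)) (at t within {0..1})"
      by (simp add: has_real_derivative_iff_has_vector_derivative)
  qed auto
  thus ?thesis
    unfolding log_quad_integral_def by (simp add: integral_unique)
qed

theorem log_quad_integral_eq:
  assumes "0 \<le> \<phi>" "\<phi> < pi"
  shows "log_quad_integral \<phi> = (ln 2)\<^sup>2 + Li2 ((sin (\<phi> / 2))\<^sup>2) / 2 - \<phi>\<^sup>2 / 4"
proof (cases "\<phi> = 0")
  case True
  thus ?thesis by (simp add: log_quad_integral_0)
next
  case False
  \<comment> \<open>This is sin^2(x/2), written so that its derivative is immediate and
    \<open>1 - a x\<close> is the argument \<open>(1 + cos x) / 2\<close> of the logarithm in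
    \<open>integral_log_quad_deriv\<close>.\<close>
  define a where "a = (\<lambda>x::real. (1 - cos x) / 2)"
  have a_eq: "a x = (sin (x / 2))\<^sup>2" for x
    using cos_double_sin[of "x / 2"] by (simp add: a_def)
  have a: "0 \<le> a x" "a x < 1" if "0 \<le> x" "x < pi" for x
    using cos_monotone_0_pi[of x pi] that by (auto simp: a_def)
  have a_deriv: "(a has_field_derivative sin x / 2) (at x within X)" for x X
    unfolding a_def by (auto intro!: derivative_eq_intros)
  define F where "F = (\<lambda>x. log_quad_integral x - Li2 (a x) / 2 + x\<^sup>2 / 4)"
  \<comment> \<open>The integral and the series are left unevaluated because their closed forms
    divide by quantities vanishing at 0. At 0 only the continuity of \<open>F\<close> is needed; the
    derivative is shown to be zero at interior points.\<close>
  have deriv: "(F has_field_derivative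
      integral {0..1} (\<lambda>t. - 2 * t * sin x / (1 + 2 * t * cos x + t\<^sup>2) / (1 + t))
      - (\<Sum>k. a x ^ k / real (Suc k)) * (sin x / 2) / 2 + x / 2) (at x within {0..<pi})"
    if "0 \<le> x" "x < pi" for x
  proof -
    have "((\<lambda>x. Li2 (a x)) has_field_derivative (\<Sum>k. a x ^ k / real (Suc k)) * (sin x / 2))
            (at x within {0..<pi})"
      using a[OF that] by (intro DERIV_chain2[OF has_field_derivative_Li2] a_deriv) auto
    moreover have "((\<lambda>x. x\<^sup>2 / 4) has_field_derivative x / 2) (at x within {0..<pi})"
      by (auto intro!: derivative_eq_intros)
    ultimately show ?thesis
      unfolding F_def
      by (rule DERIV_add[OF DERIV_diff[OF has_field_derivative_log_quad_integral[OF that] DERIV_cdivide]])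
  qed
  have "F \<phi> = F 0"
  proof (rule DERIV_isconst_end[where f = F])
    show "0 < \<phi>" using False assms by simp
    show "continuous_on {0..\<phi>} F"
      by (rule continuous_on_subset[OF DERIV_continuous_on[OF deriv]]) (use assms in auto)
    fix x assume x: "0 < x" "x < \<phi>"
    hence "a x > 0" "cos x < 1"
      using cos_monotone_0_pi[of 0 x] assms by (auto simp: a_def)
    have "(\<Sum>k. a x ^ k / real (Suc k)) = - ln (1 - a x) / a x"
      using a[of x] \<open>a x > 0\<close> x assms by (intro suminf_power_over_Suc) auto
    moreover have "1 - a x = (1 + cos x) / 2" by (simp add: a_def field_simps)
    moreover have "integral {0..1} (\<lambda>t. - 2 * t * sin x / (1 + 2 * t * cos x + t\<^sup>2) / (1 + t))
                 = - sin x / (2 * (1 - cos x)) * ln ((1 + cos x) / 2) - x / 2"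
      using x assms by (intro integral_log_quad_deriv) auto
    \<comment> \<open>Here \<open>L\<close> stands for the common logarithm
      \<open>ln (1 - a x)\<close>; the terms cancel because
      \<open>2 * a x = 1 - cos x\<close>.\<close>
    moreover have "- sin x / (2 * (1 - cos x)) * L - x / 2 - (- L / a x) * (sin x / 2) / 2 + x / 2 = 0" for L
      using \<open>cos x < 1\<close> by (simp add: a_def divide_simps)
    ultimately have "(F has_field_derivative 0) (at x within {0..<pi})"
      using deriv[of x] x assms by simp
    moreover have "at x within {0..<pi} = at x"
      using x assms by (intro at_within_interior interiorI[of "{0<..<pi}"]) auto
    ultimately show "(F has_field_derivative 0) (at x)"
      by (simp only:)
  qed
  thus ?thesis
    by (simp add: F_def a_eq log_quad_integral_0)
qed

section \<open>Summation over the angles and the value of \<open>J\<close> at odd integers\<close>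

lemma sum_odd_symmetric:
  fixes f :: "nat \<Rightarrow> real"
  assumes "\<And>k. 0 < k \<Longrightarrow> k < 2 * p + 1 \<Longrightarrow> f (2 * p + 1 - k) = f k"
  shows "(\<Sum>k<2 * p + 1. f k) = f 0 + 2 * (\<Sum>k=1..p. f k)"
proof -
  have "{..<2 * p + 1} = insert 0 ({1..p} \<union> {p+1..2*p})" by auto
  hence "(\<Sum>k<2 * p + 1. f k) = f 0 + ((\<Sum>k=1..p. f k) + (\<Sum>k=p+1..2*p. f k))"
    by (simp add: sum.union_disjoint)
  \<comment> \<open>The reflection k -> 2p + 1 - k exchanges the two blocks; only index 0 has no
    partner.\<close>
  also have "(\<Sum>k=p+1..2*p. f k) = (\<Sum>k=1..p. f k)"
    using assms
    by (intro sum.reindex_bij_witness[of _ "\<lambda>k. 2 * p + 1 - k" "\<lambda>k. 2 * p + 1 - k"]) auto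
  finally show ?thesis by simp
qed

lemma sum_squares_real: "(\<Sum>k=1..p. (real k)\<^sup>2) = real p * (real p + 1) * (2 * real p + 1) / 6"
  by (induction p) (auto simp: field_simps power2_eq_square)

text \<open>The endpoint \<open>t = 0\<close> causes no exception: for \<open>n > 0\<close> both
  kinds of power give 0 there.\<close>

lemma J_nat:
  assumes "n > 0"
  shows "J (real n) = integral {0..1} (\<lambda>t. ln (1 + t ^ n) / (1 + t))"
  unfolding J_def using assms by (intro integral_cong) (simp add: powr_realpow')

lemma J_odd:
  fixes p :: nat
  defines "m \<equiv> 2 * p + 1"
  shows "J (real m) = real m / 2 * (ln 2)\<^sup>2 - ((real m)\<^sup>2 - 1) * pi\<^sup>2 / (24 * real m)
           + 1 / 2 * (\<Sum>k<p. Li2 ((cos ((2 * real k + 1) * pi / (2 * real m)))\<^sup>2))"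
proof -
  have m: "m > 0" "odd m" by (auto simp: m_def)
  let ?\<phi> = "\<lambda>k. 2 * pi * real k / real m"
  let ?f = "\<lambda>k t. ln (1 + 2 * t * cos (?\<phi> k) + t\<^sup>2) / (1 + t)"
  have sym: "cos (?\<phi> (m - k)) = cos (?\<phi> k)" if "k < m" for k
  proof -
    have "?\<phi> (m - k) = 2 * pi - ?\<phi> k"
      using that by (simp add: of_nat_diff field_simps)
    thus ?thesis by (simp only: cos_2pi_minus)
  qed
  \<comment> \<open>The closed form applies only to angles below \<open>pi\<close>, that is to
    \<open>2 * k < m\<close>; the symmetry \<open>sym\<close> folds the other indices back into this
    range.\<close>
  have range: "0 \<le> ?\<phi> k" "?\<phi> k < pi" if "k \<le> p" for k
  proof -
    have "2 * real k < real m" using that by (simp add: m_def)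
    hence "pi * (2 * real k) < pi * real m" by (intro mult_strict_left_mono) auto
    thus "?\<phi> k < pi" using m(1) by (simp add: pos_divide_less_eq mult_ac)
  qed simp
  have split: "(\<Sum>k<m. ?f k t) = ?f 0 t + 2 * (\<Sum>k=1..p. ?f k t)" for t
    unfolding m_def by (rule sum_odd_symmetric, fold m_def) (simp only: sym)
  have halve: "a = b / 2 + c" if "2 * a = b + 2 * c" for a b c :: real
    using that by simp
  have "J (real m) = integral {0..1} (\<lambda>t. ?f 0 t / 2 + (\<Sum>k=1..p. ?f k t))"
    unfolding J_nat[OF m(1)]
  proof (rule integral_cong)
    fix t :: real
    assume "t \<in> {0..1}"
    hence "2 * (ln (1 + t ^ m) / (1 + t)) = (\<Sum>k<m. ?f k t)"
      using ln_one_plus_power_eq_sum[OF m(2), of t] by (simp add: sum_divide_distrib)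
    thus "ln (1 + t ^ m) / (1 + t) = ?f 0 t / 2 + (\<Sum>k=1..p. ?f k t)"
      unfolding split using halve by blast
  qed
  also have "\<dots> = log_quad_integral (?\<phi> 0) / 2 + (\<Sum>k=1..p. log_quad_integral (?\<phi> k))"
  proof -
    have int: "?f k integrable_on {0..1}" if "k \<le> p" for k
      using range[OF that] by (rule integrable_log_quad)
    have "integral {0..1} (\<lambda>t. ?f 0 t / 2 + (\<Sum>k=1..p. ?f k t))
        = integral {0..1} (\<lambda>t. ?f 0 t / 2) + integral {0..1} (\<lambda>t. \<Sum>k=1..p. ?f k t)"
      by (intro integral_add integrable_sum integrable_on_divide int) auto
    also have "integral {0..1} (\<lambda>t. \<Sum>k=1..p. ?f k t) = (\<Sum>k=1..p. integral {0..1} (?f k))"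
      by (intro integral_sum int) auto
    finally show ?thesis by (simp only: log_quad_integral_def integral_divide)
  qed
  also have "(\<Sum>k=1..p. log_quad_integral (?\<phi> k)) =
      (\<Sum>k=1..p. (ln 2)\<^sup>2 + Li2 ((sin (?\<phi> k / 2))\<^sup>2) / 2 - pi\<^sup>2 / (real m)\<^sup>2 * (real k)\<^sup>2)"
  proof (rule sum.cong)
    fix k assume "k \<in> {1..p}"
    hence "log_quad_integral (?\<phi> k) = (ln 2)\<^sup>2 + Li2 ((sin (?\<phi> k / 2))\<^sup>2) / 2 - (?\<phi> k)\<^sup>2 / 4"
      by (intro log_quad_integral_eq range) auto
    thus "log_quad_integral (?\<phi> k)
        = (ln 2)\<^sup>2 + Li2 ((sin (?\<phi> k / 2))\<^sup>2) / 2 - pi\<^sup>2 / (real m)\<^sup>2 * (real k)\<^sup>2"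
      by (simp add: power_mult_distrib power_divide)
  qed auto
  also have "\<dots> = real p * (ln 2)\<^sup>2 + (\<Sum>k=1..p. Li2 ((sin (?\<phi> k / 2))\<^sup>2)) / 2
      - pi\<^sup>2 / (real m)\<^sup>2 * (\<Sum>k=1..p. (real k)\<^sup>2)"
    by (simp add: sum.distrib sum_subtractf sum_divide_distrib sum_distrib_left)
  also have "pi\<^sup>2 / (real m)\<^sup>2 * (\<Sum>k=1..p. (real k)\<^sup>2) = ((real m)\<^sup>2 - 1) * pi\<^sup>2 / (24 * real m)"
  proof -
    \<comment> \<open>With p = (m - 1)/2 and p + 1 = (m + 1)/2, the product p(p + 1)(2p + 1)/6
      becomes (m^2 - 1)m/24.\<close>
    have sq: "(\<Sum>k=1..p. (real k)\<^sup>2) = ((real m)\<^sup>2 - 1) * real m / 24"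
      unfolding sum_squares_real by (simp add: m_def power2_eq_square field_simps)
    have "pi\<^sup>2 / M\<^sup>2 * ((M\<^sup>2 - 1) * M / 24) = (M\<^sup>2 - 1) * pi\<^sup>2 / (24 * M)" if "M \<noteq> 0" for M :: real
      using that by (simp add: power2_eq_square mult_ac)
    thus ?thesis unfolding sq using m(1) by simp
  qed
  also have "(\<Sum>k=1..p. Li2 ((sin (?\<phi> k / 2))\<^sup>2))
           = (\<Sum>k<p. Li2 ((cos ((2 * real k + 1) * pi / (2 * real m)))\<^sup>2))"
  \<comment> \<open>Since m - 2k = 2(p - k) + 1, the complement of the half-angle k pi/m is (2(p -
    k) + 1) pi/(2m). Reversing the order turns the range 1..p into 0..p-1.\<close>
  proof (rule sum.reindex_bij_witness[of _ "\<lambda>k. p - k" "\<lambda>k. p - k"])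
    fix k assume k: "k \<in> {1..p}"
    have "(2 * real (p - k) + 1) * pi / (2 * real m) = pi / 2 - ?\<phi> k / 2"
      using k m(1) by (simp add: of_nat_diff m_def field_simps)
    thus "Li2 ((cos ((2 * real (p - k) + 1) * pi / (2 * real m)))\<^sup>2) = Li2 ((sin (?\<phi> k / 2))\<^sup>2)"
      by (simp add: cos_diff)
  qed auto
  \<comment> \<open>The coefficient of ln^2 2 is 1/2 from index 0 plus \<open>p\<close> from the
    paired indices, which is m/2.\<close>
  finally show ?thesis
    by (simp add: log_quad_integral_0 m_def algebra_simps add_divide_distrib)
qed

section \<open>The relation between \<open>J\<close> at \<open>m\<close> and at
  \<open>1 / m\<close>\<close>

lemma J_add_J_inverse:
  assumes "m > 0"
  shows "J (real m) + J (1 / real m) = (ln 2)\<^sup>2"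
proof -
  let ?f = "\<lambda>t::real. ln (1 + t powr (1 / real m)) / (1 + t)"
  have pos: "1 + t powr x > 0" for t x :: real
    by (simp add: add_pos_nonneg)
  \<comment> \<open>The substitution asks only for continuity of the outer integrand, which holds at
    0 because the exponent \<open>1 / real m\<close> is positive.\<close>
  have "continuous_on {0..1} (\<lambda>t::real. t powr (1 / real m))"
    using assms by (intro continuous_on_powr' continuous_intros) auto
  hence "continuous_on {0..1} ?f"
    using pos[of _ "1 / real m"]
    by (intro continuous_on_divide continuous_on_ln continuous_on_add continuous_on_const
        continuous_on_id) (auto simp: less_imp_neq[symmetric])
  hence "((\<lambda>u. (real m * u ^ (m - 1)) *\<^sub>R ?f (u ^ m)) has_integral integral {0 ^ m..1 ^ m} ?f) {0..1}"
  proof (rule has_integral_substitution[where g = "\<lambda>u. u ^ m" and a = 0 and b = 1, rotated 3])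
    show "((\<lambda>u. u ^ m) has_field_derivative real m * u ^ (m - 1)) (at u within {0..1})" for u :: real
      by (auto intro!: derivative_eq_intros)
  qed (use assms in \<open>auto simp: power_le_one\<close>)
  hence "((\<lambda>u. (real m * u ^ (m - 1)) *\<^sub>R ?f (u ^ m)) has_integral J (1 / real m)) {0..1}"
    using assms by (simp add: J_def power_0_left)
  moreover have "(real m * u ^ (m - 1)) *\<^sub>R ?f (u ^ m)
               = real m * u ^ (m - 1) * ln (1 + u) / (1 + u ^ m)" if "u \<in> {0..1}" for u :: real
  proof -
    have "(u ^ m) powr (1 / real m) = u"
      using that assms by (simp add: powr_powr flip: powr_realpow')
    thus ?thesis by simp
  qed
  ultimately have I1: "((\<lambda>u. real m * u ^ (m - 1) * ln (1 + u) / (1 + u ^ m)) has_integral J (1 / real m)) {0..1}"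
    by (rule has_integral_eq[rotated])
  have posm: "1 + u ^ m > 0" if "u \<in> {0..1}" for u :: real
    using that by (simp add: add_pos_nonneg)
  have "(\<lambda>t. ln (1 + t ^ m) / (1 + t)) integrable_on {0..1::real}"
    using posm by (intro integrable_continuous_real continuous_intros ballI) force+
  hence I2: "((\<lambda>t. ln (1 + t ^ m) / (1 + t)) has_integral J (real m)) {0..1}"
    unfolding J_nat[OF assms] by (rule integrable_integral)
  \<comment> \<open>Integration by parts in the form of the product rule: the two integrands add up
    to the derivative of ln(1 + u) ln(1 + u^m), which is 0 at u = 0 and ln^2 2 at u = 1.\<close>
  have "((\<lambda>u. ln (1 + u ^ m) / (1 + u) + real m * u ^ (m - 1) * ln (1 + u) / (1 + u ^ m)) has_integral
          (ln (1 + 1) * ln (1 + 1 ^ m) - ln (1 + 0) * ln (1 + 0 ^ m))) {0..1::real}"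
  proof (rule fundamental_theorem_of_calculus)
    fix u :: real assume u: "u \<in> {0..1}"
    have "((\<lambda>u. ln (1 + u) * ln (1 + u ^ m)) has_field_derivative
            ln (1 + u ^ m) / (1 + u) + real m * u ^ (m - 1) * ln (1 + u) / (1 + u ^ m)) (at u within {0..1})"
      using u posm[OF u] by (auto intro!: derivative_eq_intros)
    thus "((\<lambda>u. ln (1 + u) * ln (1 + u ^ m)) has_vector_derivative
            ln (1 + u ^ m) / (1 + u) + real m * u ^ (m - 1) * ln (1 + u) / (1 + u ^ m)) (at u within {0..1})"
      by (simp add: has_real_derivative_iff_has_vector_derivative)
  qed auto
  from has_integral_unique[OF this has_integral_add[OF I2 I1]] show ?thesis
    by (simp add: power2_eq_square)
qed

theorem theorem2p1:
  fixes m :: nat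
  assumes "m > 0" and "odd m"
  shows "J (real m) = real m / 2 * (ln 2)\<^sup>2 - ((real m)\<^sup>2 - 1) * pi\<^sup>2 / (24 * real m)
           + 1 / 2 * (\<Sum>k<(m - 1) div 2. Li2 ((cos ((2 * real k + 1) * pi / (2 * real m)))\<^sup>2))
       \<and> J (1 / real m) = (2 - real m) / 2 * (ln 2)\<^sup>2 + ((real m)\<^sup>2 - 1) * pi\<^sup>2 / (24 * real m)
           - 1 / 2 * (\<Sum>k<(m - 1) div 2. Li2 ((cos ((2 * real k + 1) * pi / (2 * real m)))\<^sup>2))"
proof -
  obtain p where p: "m = 2 * p + 1" using assms(2) by (elim oddE)
  hence "(m - 1) div 2 = p" by simp
  hence J: "J (real m) = real m / 2 * (ln 2)\<^sup>2 - ((real m)\<^sup>2 - 1) * pi\<^sup>2 / (24 * real m)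
           + 1 / 2 * (\<Sum>k<(m - 1) div 2. Li2 ((cos ((2 * real k + 1) * pi / (2 * real m)))\<^sup>2))"
    using J_odd[of p] by (simp only: p)
  have "(2 - real m) / 2 * (ln 2)\<^sup>2 = (ln 2)\<^sup>2 - real m / 2 * (ln 2)\<^sup>2"
    by (simp add: algebra_simps diff_divide_distrib)
  with J J_add_J_inverse[OF assms(1)] show ?thesis by linarith
qed

end
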